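(* Let $N \ge n \ge 1$ and let $\lambda$ and $\rho$ be two $n$-dimensional simplices embedded in $\mathbb{R}^N$ which share a common $(n-1)$-dimensional (codimension 1) face $\tau$ and which form a non-degenerate Delaunay pair. Then the signed length of the circumcentric dual $\star\tau$ is positive.
   Context: Simplices are non-degenerate; $c_\sigma$ denotes the circumcenter of a simplex $\sigma$ (taken in the affine hull of $\sigma$). Delaunay pair: let $\lambda$ and $\rho$ be two $n$-simplices in $\mathbb{R}^N$, $N\ge n$, sharing an $(n-1)$-dimensional face $\tau$. Flatten the pair isometrically into $\mathbb{R}^n$, i.e. place each simplex isometrically in $\mathbb{R}^n$ so that the two copies of $\tau$ coincide and the two remaining vertices lie strictly on opposite sides of the hyperplane spanned by $\tau$ (if $N=n$ the simplices already lie this way). The pair is a non-degenerate Delaunay pair if, in this flattened position, the vertex of $\rho$ not in $\tau$ lies strictly outside the circumsphere of $\lambda$ (equivalently, the vertex of $\lambda$ not in $\tau$ lies strictly outside the circumsphere of $\rho$). Signed length of $\star\tau$: the dual $\star\tau$ consists of the two elementary dual edges $[c_\tau, c_\lambda]$ and $[c_\tau,c_\rho]$. The signed length of $[c_\tau,c_\lambda]$ is $\pm\|c_\lambda-c_\tau\|$, with sign $+$ if, within the $n$-dimensional affine hull of $\lambda$, the point $c_\lambda$ lies in the same half space bounded by the affine hull of $\tau$ as the vertex of $\lambda$ not in $\tau$, and sign $-$ otherwise; similarly for $\rho$. The signed length of $\star\tau$ is the sum of these two signed lengths (each measured in the affine hull of its own simplex). *)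

theory Defs
  imports "HOL-Analysis.Analysis"
begin

text \<open>
  A simplex is the convex set given by the library predicate \<open>k simplex S\<close>; its vertices are
  the extreme points of \<open>S\<close>. The definite descriptions below are meant for such sets.
\<close>

definition circumcenter :: "'a::euclidean_space set \<Rightarrow> 'a" where
  "circumcenter \<sigma> =
     (THE c. c \<in> affine hull \<sigma> \<and> (\<exists>r. \<forall>v. v extreme_point_of \<sigma> \<longrightarrow> dist c v = r))"

definition circumradius :: "'a::euclidean_space set \<Rightarrow> real" where
  "circumradius \<sigma> = (THE r. \<forall>v. v extreme_point_of \<sigma> \<longrightarrow> dist (circumcenter \<sigma>) v = r)"

text \<open>The vertex of \<open>\<sigma>\<close> that does not belong to its facet \<open>\<tau>\<close>.\<close>

definition apex :: "'a::euclidean_space set \<Rightarrow> 'a set \<Rightarrow> 'a" where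
  "apex \<sigma> \<tau> = (THE v. v extreme_point_of \<sigma> \<and> v \<notin> \<tau>)"

definition strictly_opposite_sides :: "'a::euclidean_space set \<Rightarrow> 'a \<Rightarrow> 'a \<Rightarrow> bool" where
  "strictly_opposite_sides T p q \<longleftrightarrow>
     (\<exists>a b. affine hull T = {x. a \<bullet> x = b} \<and> a \<bullet> p < b \<and> b < a \<bullet> q)"

text \<open>
  The points \<open>p\<close> and \<open>q\<close> of \<open>affine hull \<sigma>\<close> lie in the same open half space of
  \<open>affine hull \<sigma>\<close> bounded by \<open>affine hull \<tau>\<close>, which has codimension one in it. On
  \<open>affine hull \<sigma>\<close> the functional \<open>\<lambda>x. a \<bullet> x - b\<close> is unique up to a nonzero factor.
\<close>

definition same_side_in :: "'a::euclidean_space set \<Rightarrow> 'a set \<Rightarrow> 'a \<Rightarrow> 'a \<Rightarrow> bool" where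
  "same_side_in \<sigma> \<tau> p q \<longleftrightarrow>
     (\<exists>a b. affine hull \<tau> = affine hull \<sigma> \<inter> {x. a \<bullet> x = b} \<and> b < a \<bullet> p \<and> b < a \<bullet> q)"

text \<open>
  The maps \<open>f\<close> and \<open>g\<close> matter only on \<open>\<kappa>\<close> and \<open>\<rho>\<close>, respectively;
  they need not agree outside \<open>\<tau>\<close>.
\<close>

definition flattening ::
  "'a::euclidean_space set \<Rightarrow> 'a set \<Rightarrow> 'a set \<Rightarrow> ('a \<Rightarrow> 'b::euclidean_space) \<Rightarrow> ('a \<Rightarrow> 'b) \<Rightarrow> bool" where
  "flattening \<kappa> \<rho> \<tau> f g \<longleftrightarrow>
     (\<forall>x\<in>\<kappa>. \<forall>y\<in>\<kappa>. dist (f x) (f y) = dist x y) \<and>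
     (\<forall>x\<in>\<rho>. \<forall>y\<in>\<rho>. dist (g x) (g y) = dist x y) \<and>
     (\<forall>x\<in>\<tau>. f x = g x) \<and>
     strictly_opposite_sides (f ` \<tau>) (f (apex \<kappa> \<tau>)) (g (apex \<rho> \<tau>))"

text \<open>
  The first argument only supplies the type \<open>real ^ 'n\<close> into which the pair is flattened.
  A flattening of two \<open>n\<close>-simplices into \<open>n\<close>-space is unique up to an isometry of that
  space, so it does not matter which one is used.
\<close>

definition nondegenerate_delaunay_pair ::
  "'n::finite itself \<Rightarrow> 'a::euclidean_space set \<Rightarrow> 'a set \<Rightarrow> 'a set \<Rightarrow> bool" where
  "nondegenerate_delaunay_pair n \<kappa> \<rho> \<tau> \<longleftrightarrow>
     (\<exists>f g :: 'a \<Rightarrow> real ^ 'n. flattening \<kappa> \<rho> \<tau> f g \<and>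
        circumradius (f ` \<kappa>) < dist (circumcenter (f ` \<kappa>)) (g (apex \<rho> \<tau>)))"

text \<open>
  When \<open>circumcenter \<sigma>\<close> lies on \<open>affine hull \<tau>\<close> it equals \<open>circumcenter \<tau>\<close>, and the sign
  is irrelevant.
\<close>

definition signed_dual_edge_length :: "'a::euclidean_space set \<Rightarrow> 'a set \<Rightarrow> real" where
  "signed_dual_edge_length \<sigma> \<tau> =
     (if same_side_in \<sigma> \<tau> (circumcenter \<sigma>) (apex \<sigma> \<tau>) then 1 else - 1)
       * norm (circumcenter \<sigma> - circumcenter \<tau>)"

definition signed_dual_length :: "'a::euclidean_space set \<Rightarrow> 'a set \<Rightarrow> 'a set \<Rightarrow> real" where
  "signed_dual_length \<kappa> \<rho> \<tau> =
     signed_dual_edge_length \<kappa> \<tau> + signed_dual_edge_length \<rho> \<tau>"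

end

theory Submission
  imports Defs
begin

text \<open>
  Let \<open>c\<close> and \<open>r\<close> be the circumcenter and circumradius of \<open>\<tau>\<close>, let \<open>p\<close> be the apex of a
  simplex over \<open>\<tau>\<close>, and let \<open>q\<close> be the foot of the perpendicular from \<open>p\<close> to the affine hull
  of \<open>\<tau>\<close>. The circumcenter of the simplex is \<open>c + t (p - q)\<close> with
  \<open>t = (|p - c|\<^sup>2 - r\<^sup>2) / (2 |p - q|\<^sup>2)\<close>, so the signed length of its dual edge is
  \<open>t |p - q| = (|p - c|\<^sup>2 - r\<^sup>2) / (2 |p - q|)\<close>. Isometries preserve all these quantities.
  In the flattened position the two perpendiculars are antiparallel, and expanding the
  condition that the apex of \<open>\<rho>\<close> lies outside the circumsphere of \<open>\<kappa>\<close> turns it into the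
  positivity of the sum of the two signed lengths.
\<close>

section \<open>Circumcenters of affinely independent sets\<close>

text \<open>A level set of the functional \<open>d \<bullet> _\<close> is affine, so once it
  contains \<open>C\<close> it contains the affine hull of \<open>C\<close>. Orthogonality to a flat
  can thus be checked on its generators.\<close>

lemma inner_diff_affine_hull_eq_0:
  fixes C :: "'a::real_inner set"
  assumes "\<And>v w. v \<in> C \<Longrightarrow> w \<in> C \<Longrightarrow> d \<bullet> (v - w) = 0"
    and "x \<in> affine hull C" "y \<in> affine hull C"
  shows "d \<bullet> (x - y) = 0"
proof -
  obtain w where w: "w \<in> C"
    using assms(2) by (metis affine_hull_empty all_not_in_conv)
  have "affine {z. d \<bullet> z = d \<bullet> w}"
    by (rule affine_hyperplane)
  moreover have "C \<subseteq> {z. d \<bullet> z = d \<bullet> w}"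
    using assms(1)[OF _ w] by (auto simp only: inner_diff_right right_minus_eq)
  ultimately have "affine hull C \<subseteq> {z. d \<bullet> z = d \<bullet> w}"
    by (rule hull_minimal[rotated])
  with assms(2,3) have "d \<bullet> x = d \<bullet> w" "d \<bullet> y = d \<bullet> w"
    by blast+
  then show ?thesis
    by (simp add: inner_diff_right)
qed

text \<open>Comparing squared distances to two points of \<open>C\<close> cancels the radii, which
  may differ, and shows that \<open>c - c'\<close> is orthogonal to all differences of points of
  \<open>C\<close>. But \<open>c - c'\<close> is itself a direction of the affine hull, so it is
  orthogonal to itself and vanishes.\<close>

lemma equidistant_point_unique:
  fixes C :: "'a::real_inner set"
  assumes c: "c \<in> affine hull C" "\<And>v. v \<in> C \<Longrightarrow> dist c v = r"
    and c': "c' \<in> affine hull C" "\<And>v. v \<in> C \<Longrightarrow> dist c' v = r'"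
  shows "c = c'"
proof -
  have "(c - c') \<bullet> (v - w) = 0" if "v \<in> C" "w \<in> C" for v w
  proof -
    have "(c - v) \<bullet> (c - v) = (c - w) \<bullet> (c - w)"
      using c(2)[OF that(1)] c(2)[OF that(2)]
      by (simp add: dist_norm flip: power2_norm_eq_inner)
    moreover have "(c' - v) \<bullet> (c' - v) = (c' - w) \<bullet> (c' - w)"
      using c'(2)[OF that(1)] c'(2)[OF that(2)]
      by (simp add: dist_norm flip: power2_norm_eq_inner)
    ultimately show ?thesis
      by (simp add: inner_diff_left inner_diff_right inner_commute)
  qed
  from inner_diff_affine_hull_eq_0[OF this c(1) c'(1)] show ?thesis
    by simp
qed

lemma perpendicular_foot_exists:
  fixes T :: "'a::euclidean_space set"
  assumes "T \<noteq> {}"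
  obtains q where "q \<in> affine hull T"
    "\<And>x y. x \<in> affine hull T \<Longrightarrow> y \<in> affine hull T \<Longrightarrow> (p - q) \<bullet> (x - y) = 0"
proof
  let ?A = "affine hull T" and ?q = "closest_point (affine hull T) p"
  have A: "convex ?A" "closed ?A" "?A \<noteq> {}"
    using assms by (auto simp: affine_imp_convex)
  show q: "?q \<in> ?A"
    by (rule closest_point_in_set) (use A in auto)
  have 0: "(p - ?q) \<bullet> (x - ?q) = 0" if x: "x \<in> ?A" for x
  proof (rule antisym)
    show "(p - ?q) \<bullet> (x - ?q) \<le> 0"
      by (rule closest_point_dot[OF A(1,2) x])
    \<comment> \<open>The reflection of \<open>x\<close> in the closest point stays in the flat. The
      variational inequality at the reflected point is the reverse of the one at
      \<open>x\<close>.\<close>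
    have "2 *\<^sub>R ?q + (-1) *\<^sub>R x \<in> ?A"
      by (rule mem_affine[OF affine_affine_hull q x]) simp
    from closest_point_dot[OF A(1,2) this, of p]
    have "(p - ?q) \<bullet> (?q - x) \<le> 0"
      by (simp add: scaleR_2 algebra_simps)
    then show "0 \<le> (p - ?q) \<bullet> (x - ?q)"
      by (simp add: inner_diff_right)
  qed
  show "(p - ?q) \<bullet> (x - y) = 0" if "x \<in> ?A" "y \<in> ?A" for x y
    using 0[OF that(1)] 0[OF that(2)] by (simp add: inner_diff_right)
qed

text \<open>This expansion serves twice: it locates the circumcenter on the normal through
  \<open>c\<close>, and it evaluates the Delaunay condition in the flattened position.\<close>

lemma dist_add_scaleR_squared:
  fixes c n x :: "'a::real_inner"
  shows "(dist (c + t *\<^sub>R n) x)\<^sup>2 = (dist x c)\<^sup>2 - 2 * t * (n \<bullet> (x - c)) + t\<^sup>2 * (norm n)\<^sup>2"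
proof -
  have "(dist (c + t *\<^sub>R n) x)\<^sup>2 = (norm (t *\<^sub>R n - (x - c)))\<^sup>2"
    by (simp add: dist_norm algebra_simps)
  also have "\<dots> = t\<^sup>2 * (n \<bullet> n) - 2 * t * (n \<bullet> (x - c)) + (x - c) \<bullet> (x - c)"
    unfolding power2_norm_eq_inner inner_diff_left[of "t *\<^sub>R n"]
      inner_diff_right[of _ "t *\<^sub>R n"]
    by (simp add: inner_commute[of "x - c" n] power2_eq_square)
  finally show ?thesis
    by (simp add: dist_norm power2_norm_eq_inner)
qed

text \<open>Moving \<open>c\<close> along the normal \<open>p - q\<close> changes the distances to
  all points of \<open>T\<close> equally. Equating the new squared distance with that to
  \<open>p\<close> cancels the quadratic term in \<open>t\<close>. Since \<open>q - c\<close> is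
  orthogonal to \<open>p - q\<close>, the remaining linear equation has the stated \<open>t\<close>
  as its solution.\<close>

lemma equidistant_point_insert:
  fixes T :: "'a::real_inner set" and p q c :: 'a and r :: real
  defines "t \<equiv> ((dist p c)\<^sup>2 - r\<^sup>2) / (2 * (norm (p - q))\<^sup>2)"
  assumes c: "c \<in> affine hull T" "\<And>v. v \<in> T \<Longrightarrow> dist c v = r"
    and q: "q \<in> affine hull T"
    and perp: "\<And>x y. x \<in> affine hull T \<Longrightarrow> y \<in> affine hull T \<Longrightarrow> (p - q) \<bullet> (x - y) = 0"
    and pq: "p \<noteq> q"
  shows "c + t *\<^sub>R (p - q) \<in> affine hull insert p T" (is "?c \<in> _")
    and "v \<in> insert p T \<Longrightarrow> dist (c + t *\<^sub>R (p - q)) v = sqrt (r\<^sup>2 + t\<^sup>2 * (norm (p - q))\<^sup>2)"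
proof -
  let ?n = "p - q"
  have sub: "affine hull T \<subseteq> affine hull insert p T"
    by (rule hull_mono) auto
  show "?c \<in> affine hull insert p T"
    by (rule mem_affine_3_minus) (use c q sub in \<open>auto intro: hull_inc\<close>)
  have n: "(norm ?n)\<^sup>2 = ?n \<bullet> ?n" "?n \<bullet> ?n \<noteq> 0"
    using pq by (auto simp: power2_norm_eq_inner)
  have exp: "(dist ?c x)\<^sup>2 = (dist x c)\<^sup>2 - 2 * t * (?n \<bullet> (x - c)) + t\<^sup>2 * (norm ?n)\<^sup>2" for x
    by (rule dist_add_scaleR_squared)
  have "(dist ?c v)\<^sup>2 = r\<^sup>2 + t\<^sup>2 * (norm ?n)\<^sup>2" if v: "v \<in> insert p T"
  proof (cases "v = p")
    case True
    have "?n \<bullet> (p - c) = ?n \<bullet> ?n"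
      using perp[OF q c(1)] by (simp add: inner_diff_right)
    then have "2 * t * (?n \<bullet> (p - c)) = (dist p c)\<^sup>2 - r\<^sup>2"
      using n by (simp add: t_def)
    then show ?thesis
      using exp[of p] True by simp
  next
    case False
    then have vT: "v \<in> T" using v by simp
    then have "?n \<bullet> (v - c) = 0"
      by (intro perp c hull_inc)
    then show ?thesis
      using exp[of v] c(2)[OF vT] by (simp add: dist_commute)
  qed
  then show "dist ?c v = sqrt (r\<^sup>2 + t\<^sup>2 * (norm ?n)\<^sup>2)" if "v \<in> insert p T"
    using that by (metis real_sqrt_abs abs_of_nonneg zero_le_dist)
qed

lemma affine_independent_insertD:
  assumes "\<not> affine_dependent (insert p T)" "p \<notin> T"
  shows "\<not> affine_dependent T" "p \<notin> affine hull T"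
proof -
  show "\<not> affine_dependent T"
    using assms(1) affine_dependent_subset by blast
  have "insert p T - {p} = T" using assms(2) by simp
  then show "p \<notin> affine hull T"
    using assms(1) unfolding affine_dependent_def by (metis insertI1)
qed

text \<open>Induction on the vertices: by independence the new vertex lies off the affine hull of
  the earlier ones, hence differs from its foot there, and the center can be shifted along the
  perpendicular.\<close>

lemma equidistant_point_exists:
  fixes C :: "'a::euclidean_space set"
  assumes "\<not> affine_dependent C" "C \<noteq> {}"
  obtains c r where "c \<in> affine hull C" "\<And>v. v \<in> C \<Longrightarrow> dist c v = r"
proof -
  have "finite C"
    using assms(1) by (rule aff_independent_finite)
  then have "\<exists>c r. c \<in> affine hull C \<and> (\<forall>v\<in>C. dist c v = r)"
    using assms(2,1)
  proof (induction C rule: finite_ne_induct)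
    case (singleton x)
    then show ?case by (intro exI[of _ x]) auto
  next
    case (insert p T)
    note ind = affine_independent_insertD[OF insert.prems insert.hyps(3)]
    obtain c r where c: "c \<in> affine hull T" "\<And>v. v \<in> T \<Longrightarrow> dist c v = r"
      using insert.IH[OF ind(1)] by blast
    obtain q where q: "q \<in> affine hull T"
      "\<And>x y. x \<in> affine hull T \<Longrightarrow> y \<in> affine hull T \<Longrightarrow> (p - q) \<bullet> (x - y) = 0"
      using perpendicular_foot_exists[OF insert.hyps(2)] by metis
    have "p \<noteq> q" using ind(2) q(1) by auto
    from equidistant_point_insert[OF c q this] show ?case
      by blast
  qed
  then show ?thesis using that by blast
qed

text \<open>This resolves the definite descriptions. The extreme points of the simplex are exactly
  the elements of \<open>C\<close>, equidistant points in the hull are unique, and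
  \<open>C \<noteq> {}\<close> pins down the radius.\<close>

lemma circumcenter_convex_hull_eq:
  fixes C :: "'a::euclidean_space set"
  assumes "\<not> affine_dependent C" "C \<noteq> {}"
    and c: "c \<in> affine hull C" "\<And>v. v \<in> C \<Longrightarrow> dist c v = r"
  shows "circumcenter (convex hull C) = c" "circumradius (convex hull C) = r"
proof -
  have ext: "v extreme_point_of (convex hull C) \<longleftrightarrow> v \<in> C" for v
    using assms(1) by (rule extreme_point_of_convex_hull_affine_independent)
  show cc: "circumcenter (convex hull C) = c"
    unfolding circumcenter_def ext affine_hull_convex_hull
  proof (rule the_equality)
    show "c \<in> affine hull C \<and> (\<exists>r. \<forall>v. v \<in> C \<longrightarrow> dist c v = r)"
      using c by blast
  next
    fix c' assume "c' \<in> affine hull C \<and> (\<exists>r. \<forall>v. v \<in> C \<longrightarrow> dist c' v = r)"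
    then show "c' = c"
      using equidistant_point_unique[OF _ _ c] by blast
  qed
  show "circumradius (convex hull C) = r"
    unfolding circumradius_def ext cc using c(2) assms(2) by (intro the_equality) auto
qed

section \<open>Simplices with a distinguished facet\<close>

text \<open>A face of a simplex is spanned by a subset of its vertices, and counting dimensions
  leaves exactly one vertex outside the facet. All later arguments work with the vertex set
  \<open>T\<close> and this apex.\<close>

lemma simplex_facet_vertices:
  fixes \<sigma> \<tau> :: "'a::euclidean_space set"
  assumes \<sigma>: "n simplex \<sigma>" and \<tau>: "(n - 1) simplex \<tau>" "\<tau> face_of \<sigma>"
  defines "T \<equiv> {v. v extreme_point_of \<tau>}"
  shows "\<tau> = convex hull T" "\<not> affine_dependent (insert (apex \<sigma> \<tau>) T)"
    "apex \<sigma> \<tau> \<notin> T" "\<sigma> = convex hull (insert (apex \<sigma> \<tau>) T)"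
proof -
  obtain C where C: "\<not> affine_dependent C" "int (card C) = n + 1" "\<sigma> = convex hull C"
    using \<sigma> by (auto simp: simplex_def)
  obtain T' where T': "T' \<subseteq> C" "\<tau> = convex hull T'"
    using \<tau>(2) face_of_convex_hull_affine_independent[OF C(1)] C(3) by auto
  have indT': "\<not> affine_dependent T'"
    using C(1) T'(1) affine_dependent_subset by blast
  have T: "T = T'"
    using extreme_point_of_convex_hull_affine_independent[OF indT'] T'(2) T_def by auto
  have "aff_dim \<tau> = n - 1"
    using \<tau>(1) by (rule aff_dim_simplex)
  then have "int (card T) = n"
    using aff_dim_affine_independent[OF indT'] T T'(2) by (simp add: aff_dim_convex_hull)
  moreover have finC: "finite C"
    using C(1) by (rule aff_independent_finite)
  ultimately have "card (C - T) = 1"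
    using C(2) T T'(1) by (subst card_Diff_subset) (auto dest: finite_subset)
  then obtain p where p: "C - T = {p}"
    by (auto simp: card_1_singleton_iff)
  then have Cp: "C = insert p T" "p \<notin> T"
    using T T'(1) by auto
  \<comment> \<open>The description of \<open>apex\<close> asks for a vertex outside all of
    \<open>\<tau>\<close>, not only outside its vertex set; independence gives this through the
    affine hull.\<close>
  have "p \<notin> affine hull T"
    using affine_independent_insertD(2) C(1) Cp by blast
  then have "p \<notin> \<tau>"
    using T T'(2) convex_hull_subset_affine_hull by blast
  moreover have "T \<subseteq> \<tau>"
    using T T'(2) by (simp add: hull_subset)
  ultimately have "apex \<sigma> \<tau> = p"
    unfolding apex_def C(3) extreme_point_of_convex_hull_affine_independent[OF C(1)]
    using Cp(1) by (intro the_equality) auto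
  then show "\<tau> = convex hull T" "\<not> affine_dependent (insert (apex \<sigma> \<tau>) T)"
    "apex \<sigma> \<tau> \<notin> T" "\<sigma> = convex hull (insert (apex \<sigma> \<tau>) T)"
    using T T'(2) C Cp by auto
qed

text \<open>Every point of the larger hull has the form \<open>y + s *\<^sub>R (p - q)\<close> with
  \<open>y\<close> in the smaller one, and the hyperplane equation forces \<open>s = 0\<close>. This
  supplies the separating functional demanded by \<open>same_side_in\<close>.\<close>

lemma affine_hull_insert_Int_hyperplane:
  fixes T :: "'a::euclidean_space set"
  assumes q: "q \<in> affine hull T"
    and perp: "\<And>x y. x \<in> affine hull T \<Longrightarrow> y \<in> affine hull T \<Longrightarrow> (p - q) \<bullet> (x - y) = 0"
    and pq: "p \<noteq> q"
  shows "affine hull T = affine hull insert p T \<inter> {x. (p - q) \<bullet> x = (p - q) \<bullet> q}"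
proof (intro equalityI subsetI)
  fix x assume x: "x \<in> affine hull T"
  moreover have "affine hull T \<subseteq> affine hull insert p T"
    by (rule hull_mono) auto
  ultimately show "x \<in> affine hull insert p T \<inter> {x. (p - q) \<bullet> x = (p - q) \<bullet> q}"
    using perp[OF x q] by (auto simp: inner_diff_right)
next
  fix x assume x: "x \<in> affine hull insert p T \<inter> {x. (p - q) \<bullet> x = (p - q) \<bullet> q}"
  have "affine hull insert p T \<subseteq> {x. \<exists>y\<in>affine hull T. \<exists>s. x = y + s *\<^sub>R (p - q)}" (is "_ \<subseteq> ?A")
  proof (rule hull_minimal)
    show "insert p T \<subseteq> ?A"
    proof
      fix z assume "z \<in> insert p T"
      then consider "z = p" | "z \<in> T" by blast
      then show "z \<in> ?A"
      proof cases
        case 1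
        then have "z = q + 1 *\<^sub>R (p - q)" by simp
        then show ?thesis using q by blast
      next
        case 2
        then have "z \<in> affine hull T" "z = z + 0 *\<^sub>R (p - q)"
          by (auto intro: hull_inc)
        then show ?thesis by blast
      qed
    qed
    show "affine ?A"
    proof (rule affine_def[THEN iffD2], intro ballI allI impI)
      fix x y :: 'a and u v :: real
      assume "x \<in> ?A" "y \<in> ?A" and uv: "u + v = 1"
      then obtain x' s y' s' where *: "x' \<in> affine hull T" "x = x' + s *\<^sub>R (p - q)"
        "y' \<in> affine hull T" "y = y' + s' *\<^sub>R (p - q)"
        by blast
      have "u *\<^sub>R x' + v *\<^sub>R y' \<in> affine hull T"
        using mem_affine[OF affine_affine_hull *(1,3) uv] .
      moreover have "u *\<^sub>R x + v *\<^sub>R y = (u *\<^sub>R x' + v *\<^sub>R y') + (u * s + v * s') *\<^sub>R (p - q)"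
        unfolding *(2,4) by (simp add: algebra_simps)
      ultimately show "u *\<^sub>R x + v *\<^sub>R y \<in> ?A" by blast
    qed
  qed
  then obtain y s where y: "y \<in> affine hull T" "x = y + s *\<^sub>R (p - q)"
    using x by blast
  have "(p - q) \<bullet> (y + s *\<^sub>R (p - q) - q) = 0"
    using x y(2) by (simp add: inner_diff_right)
  moreover have "(p - q) \<bullet> (y - q) = 0"
    using perp[OF y(1) q] .
  ultimately have "s * ((p - q) \<bullet> (p - q)) = 0"
    by (simp add: inner_diff_right inner_add_right)
  then have "s = 0" using pq by simp
  then show "x \<in> affine hull T" using y by simp
qed

text \<open>The circumcenters of \<open>\<sigma>\<close> and \<open>\<tau>\<close> differ by
  \<open>t *\<^sub>R (p - q)\<close>, and the same-side condition amounts to \<open>t > 0\<close>.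
  The sign therefore turns \<open>\<bar>t\<bar>\<close> back into \<open>t\<close>.\<close>

lemma signed_dual_edge_length_eq:
  fixes T :: "'a::euclidean_space set"
  assumes ind: "\<not> affine_dependent (insert p T)" "p \<notin> T" "T \<noteq> {}"
    and \<sigma>: "\<sigma> = convex hull insert p T" and \<tau>: "\<tau> = convex hull T" and p: "apex \<sigma> \<tau> = p"
    and c: "c \<in> affine hull T" "\<And>v. v \<in> T \<Longrightarrow> dist c v = r"
    and q: "q \<in> affine hull T"
      "\<And>x y. x \<in> affine hull T \<Longrightarrow> y \<in> affine hull T \<Longrightarrow> (p - q) \<bullet> (x - y) = 0"
  shows "signed_dual_edge_length \<sigma> \<tau> = ((dist p c)\<^sup>2 - r\<^sup>2) / (2 * norm (p - q))"
proof -
  define t where "t = ((dist p c)\<^sup>2 - r\<^sup>2) / (2 * (norm (p - q))\<^sup>2)"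
  note ind' = affine_independent_insertD[OF ind(1,2)]
  have pq: "p \<noteq> q" using ind' q(1) by auto
  note ins = equidistant_point_insert[OF c q pq, folded t_def]
  have cc: "circumcenter \<sigma> = c + t *\<^sub>R (p - q)"
    unfolding \<sigma> by (rule circumcenter_convex_hull_eq(1)[OF ind(1) _ ins]) auto
  have c\<tau>: "circumcenter \<tau> = c"
    unfolding \<tau> by (rule circumcenter_convex_hull_eq(1)[OF ind'(1) ind(3) c])
  have aff: "affine hull \<sigma> = affine hull insert p T" "affine hull \<tau> = affine hull T"
    by (simp_all add: \<sigma> \<tau>)
  have "same_side_in \<sigma> \<tau> (circumcenter \<sigma>) (apex \<sigma> \<tau>) \<longleftrightarrow> t > 0"
  proof
    assume "same_side_in \<sigma> \<tau> (circumcenter \<sigma>) (apex \<sigma> \<tau>)"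
    then obtain a b where ab: "affine hull T = affine hull insert p T \<inter> {x. a \<bullet> x = b}"
      "b < a \<bullet> (c + t *\<^sub>R (p - q))" "b < a \<bullet> p"
      unfolding same_side_in_def aff cc p by blast
    \<comment> \<open>Whatever functional witnesses the same-side condition, it takes the value
      \<open>b\<close> at \<open>c\<close> and \<open>q\<close>, so its excess over \<open>b\<close>
      at the circumcenter is \<open>t\<close> times its excess at \<open>p\<close>.\<close>
    have "a \<bullet> c = b" "a \<bullet> q = b" using c(1) q(1) ab(1) by auto
    then have "0 < t * (a \<bullet> p - b)" "0 < a \<bullet> p - b"
      using ab(2,3) by (auto simp: inner_add_right inner_diff_right)
    then show "t > 0" by (simp add: zero_less_mult_iff)
  next
    assume t: "t > 0"
    have pos: "(p - q) \<bullet> (p - q) > 0" using pq by simp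
    have "(p - q) \<bullet> c = (p - q) \<bullet> q"
      using q(2)[OF c(1) q(1)] by (simp add: inner_diff_right)
    then have "(p - q) \<bullet> q < (p - q) \<bullet> (c + t *\<^sub>R (p - q))"
      using mult_pos_pos[OF t pos] by (simp only: inner_add_right inner_scaleR_right)
    moreover have "(p - q) \<bullet> q < (p - q) \<bullet> p"
      using pos by (simp add: inner_diff_right)
    ultimately show "same_side_in \<sigma> \<tau> (circumcenter \<sigma>) (apex \<sigma> \<tau>)"
      unfolding same_side_in_def aff cc p
      using affine_hull_insert_Int_hyperplane[OF q pq] by blast
  qed
  \<comment> \<open>For \<open>t = 0\<close> the definition chooses the sign \<open>-1\<close>,
    which is harmless because the norm is zero.\<close>
  then have "signed_dual_edge_length \<sigma> \<tau> = t * norm (p - q)"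
    unfolding signed_dual_edge_length_def cc c\<tau> by auto
  also have "\<dots> = ((dist p c)\<^sup>2 - r\<^sup>2) / (2 * norm (p - q))"
    using pq by (simp add: t_def power2_eq_square)
  finally show ?thesis .
qed

section \<open>Extending isometries to affine hulls\<close>

text \<open>Polarization shows that \<open>f\<close>, recentered at a point of \<open>S\<close>,
  preserves inner products, so it agrees with a linear map fixed by its values on a basis. The
  extension matters because feet of perpendiculars and circumcenters may lie outside the simplices
  on which the flattening maps are isometric.\<close>

lemma isometry_extends_to_affine_hull:
  fixes f :: "'a::euclidean_space \<Rightarrow> 'b::euclidean_space"
  assumes iso: "\<And>x y. x \<in> S \<Longrightarrow> y \<in> S \<Longrightarrow> dist (f x) (f y) = dist x y"
  obtains L b where "linear L" "\<And>x. x \<in> S \<Longrightarrow> f x = b + L x"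
    "\<And>x y. x \<in> affine hull S \<Longrightarrow> y \<in> affine hull S \<Longrightarrow> dist (b + L x) (b + L y) = dist x y"
proof (cases "S = {}")
  case True
  then show ?thesis using that[of "\<lambda>x. 0" 0] by (simp add: linear_zero)
next
  case False
  then obtain s where s: "s \<in> S" by blast
  let ?D = "(\<lambda>x. x - s) ` S"
  define h where "h d = f (s + d) - f s" for d
  have h: "h d \<bullet> h e = d \<bullet> e" if "d \<in> ?D" "e \<in> ?D" for d e
  proof -
    have *: "s + d \<in> S" "s + e \<in> S" using that by auto
    have "norm (h d) = norm d" "norm (h e) = norm e"
      using iso[OF *(1) s] iso[OF *(2) s] by (auto simp: h_def dist_norm)
    moreover have "norm (h d - h e) = norm (d - e)"
      using iso[OF *] by (simp add: h_def dist_norm)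
    ultimately show ?thesis
      by (simp add: dot_norm_neg)
  qed
  obtain B where B: "B \<subseteq> ?D" "independent B" "?D \<subseteq> span B"
    using maximal_independent_subset by blast
  obtain L where L: "linear L" "\<And>x. x \<in> B \<Longrightarrow> L x = h x"
    using linear_independent_extend[OF B(2), of h] by blast
  \<comment> \<open>As \<open>h\<close> is not yet known to be linear, linearity is used in one
    argument at a time, first on the right and then on the left.\<close>
  have h_L: "h d \<bullet> L e = d \<bullet> e" if "d \<in> ?D" "e \<in> span B" for d e
    using that(2)
  proof (induction e rule: span_induct)
    case base
    then show ?case
      by (auto simp: subspace_def linear_0[OF L(1)] linear_add[OF L(1)] linear_cmul[OF L(1)]
          inner_add_right)
  next
    case (step e)
    then show ?case using h[OF that(1)] B(1) L(2) by auto
  qed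
  have L_L: "L d \<bullet> L e = d \<bullet> e" if "d \<in> span B" "e \<in> span B" for d e
    using that(1)
  proof (induction d rule: span_induct)
    case base
    then show ?case
      by (auto simp: subspace_def linear_0[OF L(1)] linear_add[OF L(1)] linear_cmul[OF L(1)]
          inner_add_left)
  next
    case (step d)
    then show ?case using h_L[OF _ that(2)] B(1) L(2) by auto
  qed
  have hL: "h d = L d" if d: "d \<in> ?D" for d
  proof -
    have "d \<in> span B" using d B(3) by blast
    \<comment> \<open>All inner products in this expansion equal \<open>d \<bullet> d\<close>, with
      coefficients adding up to zero.\<close>
    then have "(h d - L d) \<bullet> (h d - L d) = 0"
      using h[OF d d] h_L[OF d] L_L by (simp add: inner_diff_left inner_diff_right inner_commute)
    then show ?thesis by simp
  qed
  show ?thesis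
  proof
    show "linear L" by (rule L(1))
    show "f x = (f s - L s) + L x" if "x \<in> S" for x
      using hL[of "x - s"] that by (simp add: h_def linear_diff[OF L(1)] algebra_simps)
    have span: "x - s \<in> span B" if "x \<in> affine hull S" for x
    proof -
      have "affine ((+) s ` span B)"
        by (simp add: subspace_imp_affine flip: affine_translation)
      moreover have "S \<subseteq> (+) s ` span B"
      proof
        fix x assume "x \<in> S"
        then have "x - s \<in> span B" using B(3) by blast
        moreover have "x = s + (x - s)" by simp
        ultimately show "x \<in> (+) s ` span B" by blast
      qed
      ultimately have "affine hull S \<subseteq> (+) s ` span B"
        by (rule hull_minimal[rotated])
      with that show ?thesis by auto
    qed
    fix x y assume "x \<in> affine hull S" "y \<in> affine hull S"
    then have "(x - s) - (y - s) \<in> span B"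
      by (intro span_diff span)
    then have "x - y \<in> span B" by simp
    from L_L[OF this this] show "dist ((f s - L s) + L x) ((f s - L s) + L y) = dist x y"
      by (simp add: dist_norm norm_eq linear_diff[OF L(1)])
  qed
qed

lemma affine_hull_affine_image:
  fixes L :: "'a::euclidean_space \<Rightarrow> 'b::real_normed_vector"
  assumes "linear L"
  shows "affine hull ((\<lambda>x. b + L x) ` C) = (\<lambda>x. b + L x) ` (affine hull C)"
proof -
  have "bounded_linear L" using assms by (simp add: linear_conv_bounded_linear)
  from affine_hull_linear_image[OF this, of C, symmetric] show ?thesis
    using affine_hull_translation[of b "L ` C"] by (simp add: image_image)
qed

lemma convex_hull_affine_image:
  fixes L :: "'a::real_vector \<Rightarrow> 'b::real_vector"
  assumes "linear L"
  shows "convex hull ((\<lambda>x. b + L x) ` C) = (\<lambda>x. b + L x) ` (convex hull C)"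
  using convex_hull_translation[of b "L ` C"] convex_hull_linear_image[OF assms, of C, symmetric]
  by (simp add: image_image)

text \<open>The component of \<open>n\<close> orthogonal to \<open>a\<close> is by assumption
  orthogonal to \<open>n\<close> as well, hence to itself.\<close>

lemma parallel_of_orthogonal_complement:
  fixes a n :: "'a::real_inner"
  assumes "\<And>d. a \<bullet> d = 0 \<Longrightarrow> n \<bullet> d = 0"
  obtains k where "n = k *\<^sub>R a"
proof
  let ?d = "n - (a \<bullet> n / (a \<bullet> a)) *\<^sub>R a"
  \<comment> \<open>If \<open>a = 0\<close>, the quotient is \<open>0\<close> by the convention on
    division and the witness is \<open>k = 0\<close>.\<close>
  have "a \<bullet> ?d = 0"
    by (cases "a = 0") (auto simp: inner_diff_right)
  with assms[OF this] have "?d \<bullet> ?d = 0"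
    by (simp add: inner_diff_left)
  then show "n = (a \<bullet> n / (a \<bullet> a)) *\<^sub>R a"
    by simp
qed

text \<open>An affine dependence among the image points is the image of a relation inside the hull
  of \<open>C\<close>, and injectivity there pulls it back.\<close>

lemma affine_independent_injective_image:
  fixes L :: "'a::euclidean_space \<Rightarrow> 'b::euclidean_space"
  assumes "linear L" "\<not> affine_dependent C"
    and inj: "inj_on (\<lambda>x. b + L x) (affine hull C)"
  shows "\<not> affine_dependent ((\<lambda>x. b + L x) ` C)"
proof
  assume "affine_dependent ((\<lambda>x. b + L x) ` C)"
  then obtain x where x: "x \<in> C" "b + L x \<in> affine hull ((\<lambda>x. b + L x) ` C - {b + L x})"
    by (auto simp: affine_dependent_def)
  have "(\<lambda>x. b + L x) ` C - {b + L x} \<subseteq> (\<lambda>x. b + L x) ` (C - {x})"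
    by auto
  then have "b + L x \<in> affine hull ((\<lambda>x. b + L x) ` (C - {x}))"
    using x(2) hull_mono by blast
  also have "affine hull ((\<lambda>x. b + L x) ` (C - {x})) = (\<lambda>x. b + L x) ` (affine hull (C - {x}))"
    by (rule affine_hull_affine_image[OF assms(1)])
  finally obtain y where y: "y \<in> affine hull (C - {x})" "b + L x = b + L y"
    by blast
  have "y \<in> affine hull C" using y(1) hull_mono[of "C - {x}" C] by blast
  then have "x = y" using inj_onD[OF inj y(2)] x(1) by (simp add: hull_inc)
  then show False using y(1) x(1) assms(2) by (auto simp: affine_dependent_def)
qed

section \<open>Positivity of the signed dual length\<close>

theorem theorem3:
  fixes \<kappa> \<rho> \<tau> :: "(real ^ 'N) set"
  assumes "CARD('n::finite) \<le> CARD('N::finite)"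
    and "int CARD('n) simplex \<kappa>"
    and "int CARD('n) simplex \<rho>"
    and "(int CARD('n) - 1) simplex \<tau>"
    and "\<tau> face_of \<kappa>"
    and "\<tau> face_of \<rho>"
    and "nondegenerate_delaunay_pair TYPE('n) \<kappa> \<rho> \<tau>"
  shows "signed_dual_length \<kappa> \<rho> \<tau> > 0"
proof -
  define T where "T = {v. v extreme_point_of \<tau>}"
  define p where "p = apex \<kappa> \<tau>"
  define p' where "p' = apex \<rho> \<tau>"
  note \<kappa> = simplex_facet_vertices[OF assms(2,4,5), folded T_def p_def]
  note \<rho> = simplex_facet_vertices[OF assms(3,4,6), folded T_def p'_def]
  have indT: "\<not> affine_dependent T" "p \<notin> affine hull T"
    using affine_independent_insertD[OF \<kappa>(2,3)] by auto
  have indT': "p' \<notin> affine hull T"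
    using affine_independent_insertD[OF \<rho>(2,3)] by auto
  \<comment> \<open>\<open>CARD('n)\<close> is at least 1, so the dimension of \<open>\<tau>\<close>
    is not \<open>-1\<close>.\<close>
  have T0: "T \<noteq> {}"
  proof
    assume "T = {}"
    then have "\<tau> = {}" using \<kappa>(1) by simp
    then have "int CARD('n) - 1 = - 1"
      using aff_dim_simplex[OF assms(4)] by simp
    then show False by simp
  qed
  obtain c r where c: "c \<in> affine hull T" "\<And>v. v \<in> T \<Longrightarrow> dist c v = r"
    using equidistant_point_exists[OF indT(1) T0] by metis
  obtain q where q: "q \<in> affine hull T"
    "\<And>x y. x \<in> affine hull T \<Longrightarrow> y \<in> affine hull T \<Longrightarrow> (p - q) \<bullet> (x - y) = 0"
    using perpendicular_foot_exists[OF T0] by metis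
  obtain q' where q': "q' \<in> affine hull T"
    "\<And>x y. x \<in> affine hull T \<Longrightarrow> y \<in> affine hull T \<Longrightarrow> (p' - q') \<bullet> (x - y) = 0"
    using perpendicular_foot_exists[OF T0] by metis
  have pq: "p \<noteq> q" "p' \<noteq> q'" using indT indT' q q' by auto
  have len: "signed_dual_edge_length \<kappa> \<tau> = ((dist p c)\<^sup>2 - r\<^sup>2) / (2 * norm (p - q))"
    by (rule signed_dual_edge_length_eq[OF \<kappa>(2,3) T0 \<kappa>(4,1) p_def[symmetric] c q])
  have len': "signed_dual_edge_length \<rho> \<tau> = ((dist p' c)\<^sup>2 - r\<^sup>2) / (2 * norm (p' - q'))"
    by (rule signed_dual_edge_length_eq[OF \<rho>(2,3) T0 \<rho>(4,1) p'_def[symmetric] c q'])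

  obtain f g :: "real ^ 'N \<Rightarrow> real ^ 'n" where fl: "flattening \<kappa> \<rho> \<tau> f g"
    and del: "circumradius (f ` \<kappa>) < dist (circumcenter (f ` \<kappa>)) (g p')"
    using assms(7) unfolding nondegenerate_delaunay_pair_def p'_def by blast
  have f: "\<And>x y. x \<in> \<kappa> \<Longrightarrow> y \<in> \<kappa> \<Longrightarrow> dist (f x) (f y) = dist x y"
    and g: "\<And>x y. x \<in> \<rho> \<Longrightarrow> y \<in> \<rho> \<Longrightarrow> dist (g x) (g y) = dist x y"
    and fg: "\<And>x. x \<in> \<tau> \<Longrightarrow> f x = g x"
    and opp: "strictly_opposite_sides (f ` \<tau>) (f p) (g p')"
    using fl unfolding flattening_def p_def p'_def by blast+
  obtain L b where L: "linear L" "\<And>x. x \<in> \<kappa> \<Longrightarrow> f x = b + L x"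
    "\<And>x y. x \<in> affine hull \<kappa> \<Longrightarrow> y \<in> affine hull \<kappa> \<Longrightarrow> dist (b + L x) (b + L y) = dist x y"
    using isometry_extends_to_affine_hull[OF f] by metis
  obtain M e where M: "linear M" "\<And>x. x \<in> \<rho> \<Longrightarrow> g x = e + M x"
    "\<And>x y. x \<in> affine hull \<rho> \<Longrightarrow> y \<in> affine hull \<rho> \<Longrightarrow> dist (e + M x) (e + M y) = dist x y"
    using isometry_extends_to_affine_hull[OF g] by metis
  \<comment> \<open>\<open>F\<close> and \<open>G\<close> are affine maps on the whole space that
    agree with \<open>f\<close> on \<open>\<kappa>\<close> and with \<open>g\<close> on
    \<open>\<rho>\<close>.\<close>
  define F where "F x = b + L x" for x
  define G where "G x = e + M x" for x
  have aff: "affine hull \<kappa> = affine hull insert p T" "affine hull \<rho> = affine hull insert p' T"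
    "affine hull \<tau> = affine hull T"
    using \<kappa>(4) \<rho>(4) \<kappa>(1) by (metis affine_hull_convex_hull)+
  have sub: "affine hull T \<subseteq> affine hull \<kappa>" "affine hull T \<subseteq> affine hull \<rho>"
    unfolding aff by (auto intro: hull_mono[THEN subsetD])
  have p: "p \<in> \<kappa>" "p' \<in> \<rho>" "p \<in> affine hull \<kappa>" "p' \<in> affine hull \<rho>"
    using \<kappa>(4) \<rho>(4) by (auto simp: aff intro: hull_inc)
  have \<tau>: "\<tau> \<subseteq> \<kappa>" "\<tau> \<subseteq> \<rho>"
    using assms(5,6) by (auto dest: face_of_imp_subset)
  \<comment> \<open>Two affine maps agree on an affine set, and this set contains the vertices of
    \<open>\<tau>\<close>.\<close>
  have FG: "F x = G x" if "x \<in> affine hull T" for x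
  proof -
    have "affine {x. F x = G x}"
      unfolding affine_def
    proof (intro ballI allI impI, unfold mem_Collect_eq)
      fix x y u v assume xy: "F x = G x" "F y = G y" "u + v = (1::real)"
      have "F (u *\<^sub>R x + v *\<^sub>R y) = (u + v) *\<^sub>R b + L (u *\<^sub>R x + v *\<^sub>R y)"
        using xy by (simp add: F_def)
      also have "\<dots> = u *\<^sub>R F x + v *\<^sub>R F y"
        by (simp add: F_def linear_add[OF L(1)] linear_cmul[OF L(1)] algebra_simps)
      also have "\<dots> = (u + v) *\<^sub>R e + M (u *\<^sub>R x + v *\<^sub>R y)"
        unfolding xy(1,2) by (simp add: G_def linear_add[OF M(1)] linear_cmul[OF M(1)] algebra_simps)
      finally show "F (u *\<^sub>R x + v *\<^sub>R y) = G (u *\<^sub>R x + v *\<^sub>R y)"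
        using xy by (simp add: G_def)
    qed
    moreover have "T \<subseteq> {x. F x = G x}"
      using fg L(2) M(2) \<tau> hull_subset[of T convex] by (fastforce simp: F_def G_def \<kappa>(1))
    ultimately have "affine hull T \<subseteq> {x. F x = G x}"
      by (rule hull_minimal[rotated])
    with that show ?thesis by auto
  qed
  \<comment> \<open>\<open>t\<close> places the circumcenter of \<open>\<kappa>\<close> on the
    normal through \<open>c\<close>, and \<open>R\<close> is the circumradius of
    \<open>\<kappa>\<close>.\<close>
  define t where "t = ((dist p c)\<^sup>2 - r\<^sup>2) / (2 * (norm (p - q))\<^sup>2)"
  define R where "R = sqrt (r\<^sup>2 + t\<^sup>2 * (norm (p - q))\<^sup>2)"
  have dist_F: "dist (F x) (F y) = dist x y" if "x \<in> affine hull \<kappa>" "y \<in> affine hull \<kappa>" for x y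
    using L(3)[OF that] by (simp add: F_def)
  have dist_G: "dist (G x) (G y) = dist x y" if "x \<in> affine hull \<rho>" "y \<in> affine hull \<rho>" for x y
    using M(3)[OF that] by (simp add: G_def)
  have f\<kappa>: "f ` \<kappa> = convex hull (F ` insert p T)"
    unfolding F_def convex_hull_affine_image[OF L(1)] \<kappa>(4)[symmetric] using L(2) by auto
  have indF: "\<not> affine_dependent (F ` insert p T)"
    unfolding F_def
  proof (rule affine_independent_injective_image[OF L(1) \<kappa>(2)])
    show "inj_on (\<lambda>x. b + L x) (affine hull insert p T)"
      unfolding aff(1)[symmetric] using L(3) by (intro inj_onI) (metis dist_eq_0_iff)
  qed
  have affF: "affine hull (F ` C) = F ` (affine hull C)" for C
    unfolding F_def by (rule affine_hull_affine_image[OF L(1)])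
  let ?c = "c + t *\<^sub>R (p - q)"
  have ck: "?c \<in> affine hull insert p T" "\<And>v. v \<in> insert p T \<Longrightarrow> dist ?c v = R"
    unfolding t_def R_def using equidistant_point_insert[OF c q pq(1)] by blast+
  have Fc: "F ?c \<in> affine hull (F ` insert p T)"
    unfolding affF using ck(1) by blast
  have FR: "dist (F ?c) v = R" if v: "v \<in> F ` insert p T" for v
  proof -
    obtain w where w: "v = F w" "w \<in> insert p T" using v by (rule imageE)
    have "w \<in> affine hull \<kappa>" unfolding aff(1) by (rule hull_inc[OF w(2)])
    moreover have "?c \<in> affine hull \<kappa>" unfolding aff(1) by (rule ck(1))
    ultimately have "dist (F ?c) (F w) = dist ?c w" by (intro dist_F)
    then show ?thesis unfolding w(1) ck(2)[OF w(2)] .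
  qed
  have "R < dist (F ?c) (G p')"
    using del circumcenter_convex_hull_eq[OF indF _ Fc FR] M(2)[OF p(2)]
    by (simp add: f\<kappa> G_def)
  moreover have "0 \<le> R" by (simp add: R_def)
  ultimately have "R\<^sup>2 < (dist (F ?c) (G p'))\<^sup>2"
    by (simp add: power_strict_mono)
  then have out: "r\<^sup>2 + t\<^sup>2 * (norm (p - q))\<^sup>2 < (dist (F ?c) (G p'))\<^sup>2"
    by (simp add: R_def)

  define n where "n = F p - F q"
  define m where "m = G p' - G q'"
  have norms: "norm n = norm (p - q)" "norm m = norm (p' - q')" "dist (G p') (G c) = dist p' c"
    using dist_F[of p q] dist_G[of p' q'] dist_G[of p' c] p sub q(1) q'(1) c(1)
    by (auto simp: n_def m_def dist_norm)
  have n_perp: "n \<bullet> (F x - F q) = 0" if x: "x \<in> affine hull T" for x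
  proof -
    \<comment> \<open>By polarization this inner product depends only on the three distances among
      \<open>p\<close>, \<open>q\<close> and \<open>x\<close>, which \<open>F\<close>
      preserves.\<close>
    have "n \<bullet> (F x - F q) = (p - q) \<bullet> (x - q)"
      using dist_F[of p q] dist_F[of x q] dist_F[of p x] p sub q(1) x
      by (simp add: n_def dot_norm_neg dist_norm subset_iff)
    then show ?thesis using q(2)[OF x q(1)] by simp
  qed
  have m_perp: "m \<bullet> (G x - G q') = 0" if x: "x \<in> affine hull T" for x
  proof -
    have "m \<bullet> (G x - G q') = (p' - q') \<bullet> (x - q')"
      using dist_G[of p' q'] dist_G[of x q'] dist_G[of p' x] p sub q'(1) x
      by (simp add: m_def dot_norm_neg dist_norm subset_iff)
    then show ?thesis using q'(2)[OF x q'(1)] by simp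
  qed
  obtain a \<beta> where H: "affine hull (f ` \<tau>) = {x. a \<bullet> x = \<beta>}" "a \<bullet> f p < \<beta>" "\<beta> < a \<bullet> g p'"
    using opp unfolding strictly_opposite_sides_def by blast
  have "f ` \<tau> = F ` \<tau>" using L(2) \<tau>(1) by (intro image_cong) (auto simp: F_def)
  then have H1: "F ` (affine hull T) = {x. a \<bullet> x = \<beta>}"
    using H(1) affF aff(3) by simp
  have H2: "a \<bullet> F x = \<beta>" if "x \<in> affine hull T" for x
    using H1 that by blast
  have "a \<bullet> F p < \<beta>" "\<beta> < a \<bullet> G p'"
    using H(2,3) L(2)[OF p(1)] M(2)[OF p(2)] by (auto simp: F_def G_def)
  \<comment> \<open>The feet of both perpendiculars are mapped into the separating hyperplane, so
    the sides of the two apexes decide the signs.\<close>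
  then have an: "a \<bullet> n < 0" and am: "0 < a \<bullet> m"
    using H2[OF q(1)] H2[OF q'(1)] FG[OF q'(1)] by (auto simp: n_def m_def inner_diff_right)
  \<comment> \<open>The image of the hull of \<open>T\<close> is a full hyperplane of the target, so
    every \<open>d\<close> orthogonal to \<open>a\<close> is a difference of its points. Hence
    \<open>n\<close>, and likewise \<open>m\<close>, is a multiple of \<open>a\<close>.\<close>
  have "n \<bullet> d = 0" if "a \<bullet> d = 0" for d
  proof -
    have "F q + d \<in> F ` (affine hull T)"
      unfolding H1 using that H2[OF q(1)] by (simp add: inner_add_right)
    then obtain x where "x \<in> affine hull T" "d = F x - F q"
      by (metis add_diff_cancel_left' imageE)
    then show ?thesis using n_perp by simp
  qed
  then obtain k where k: "n = k *\<^sub>R a"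
    using parallel_of_orthogonal_complement by metis
  have "m \<bullet> d = 0" if "a \<bullet> d = 0" for d
  proof -
    have "F q' + d \<in> F ` (affine hull T)"
      unfolding H1 using that H2[OF q'(1)] by (simp add: inner_add_right)
    then obtain x where "x \<in> affine hull T" "d = F x - F q'"
      by (metis add_diff_cancel_left' imageE)
    then show ?thesis using m_perp FG q'(1) by simp
  qed
  then obtain l where l: "m = l *\<^sub>R a"
    using parallel_of_orthogonal_complement by metis
  have "k < 0" "0 < l"
    using an am k l inner_ge_zero[of a] by (auto simp: mult_less_0_iff zero_less_mult_iff)
  then have nm: "n \<bullet> m = - (norm n * norm m)"
    by (simp add: k l power2_eq_square flip: power2_norm_eq_inner)

  have Fck: "F ?c = F c + t *\<^sub>R n"
    by (simp add: F_def n_def linear_add[OF L(1)] linear_diff[OF L(1)] linear_cmul[OF L(1)])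
  \<comment> \<open>Apart from \<open>m\<close>, all terms are directions of the common hyperplane
    and orthogonal to \<open>n\<close>.\<close>
  have "G p' - F c = m + (F q' - F q) - (F c - F q)"
    using FG[OF q'(1)] by (simp add: m_def)
  then have n_Gp: "n \<bullet> (G p' - F c) = - (norm n * norm m)"
    using nm n_perp[OF c(1)] n_perp[OF q'(1)] by (simp add: inner_diff_right inner_add_right)
  have "(dist (F ?c) (G p'))\<^sup>2 = (dist (G p') (F c))\<^sup>2 - 2 * t * (n \<bullet> (G p' - F c)) + t\<^sup>2 * (norm n)\<^sup>2"
    unfolding Fck by (rule dist_add_scaleR_squared)
  also have "\<dots> = (dist p' c)\<^sup>2 + 2 * t * norm (p - q) * norm (p' - q') + t\<^sup>2 * (norm (p - q))\<^sup>2"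
    using n_Gp norms FG[OF c(1)] by simp
  \<comment> \<open>The term \<open>t\<^sup>2 * (norm (p - q))\<^sup>2\<close> occurs both in the
    squared circumradius and in the squared distance and cancels. Dividing by
    \<open>2 * norm (p' - q')\<close> then yields the two signed lengths.\<close>
  finally have "0 < ((dist p' c)\<^sup>2 - r\<^sup>2) + (t * norm (p - q)) * (2 * norm (p' - q'))"
    using out by (simp add: algebra_simps)
  then have "0 < (((dist p' c)\<^sup>2 - r\<^sup>2) + (t * norm (p - q)) * (2 * norm (p' - q'))) / (2 * norm (p' - q'))"
    using pq by simp
  also have "\<dots> = signed_dual_edge_length \<rho> \<tau> + t * norm (p - q)"
    using pq by (simp add: len' add_divide_distrib)
  also have "t * norm (p - q) = signed_dual_edge_length \<kappa> \<tau>"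
    using pq by (simp add: len t_def power2_eq_square)
  finally show ?thesis
    by (simp add: signed_dual_length_def)
qed

end
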